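(* Let $\mathcal C_s=\frac{c_h+c_s\theta_s}{\mu+\theta_s}$ and $\mathcal C_q=\frac{c_h}{\theta_q}+c_q$. If $\mathcal C_s\le\mathcal C_q$, then the optimal arrival rate policy $\vec\lambda^*=(\lambda_0^*,\ldots,\lambda_N^* )$ has a monotone decreasing structure, i.e. $\lambda_n^*\ge\lambda_{n+1}^*$ for all $n=0,\ldots,N-1$.
   Context: Model: a Markovian queue with $m$ servers, capacity $N$, maximal arrival rate $\Lambda$, service rate $\mu$, abandonment rates $\theta_s$ (in service) and $\theta_q$ (waiting), holding cost $c_h$, abandonment costs $c_s$ (in service) and $c_q$ (waiting). The parameters are integers $1\le m\le N<\infty$ and reals $\Lambda>0$, $\mu>0$, $\theta_q>0$, $\theta_s\ge 0$, $c_h,c_q,c_s\ge 0$, $0\le a<b<\infty$. $F$ is a continuous cumulative distribution function supported on $[a,b]$ ($F(a)=0$, $F(b)=1$) with a positive density on $[a,b]$; $\bar F=1-F$, and for $y\in[0,1]$, $\bar F^{-1}(y)=\inf\{x\in[a,b]:\bar F(x)\le y\}$. Death rates: $\gamma_n=\min\{n,m\}(\mu+\theta_s)+\max\{n-m,0\}\theta_q$. The time unit is scaled so that $\Lambda+m(\mu+\theta_s)+(N-m)\theta_q=1$. Markov decision process: states $\{0,\ldots,N\}$; actions $A_n=[0,\Lambda]$ for $n<N$ and $A_N=\{0\}$; rewards $$r_n(\lambda)=\lambda\bar F^{-1}(\lambda/\Lambda)-nc_h-\min\{n,m\}c_s\theta_s-\max\{n-m,0\}c_q\theta_q ;$$ transition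 probabilities $\mathbf P(n+1|n,\lambda)=\lambda$ for $n\le N-1$, $\mathbf P(n-1|n,\lambda)=\gamma_n$ for $n\ge1$, $\mathbf P(n|n,\lambda)=1-\lambda-\gamma_n$, and $0$ otherwise. Let $g^*\in\mathbb R$ (optimal long-run average gain) and $h:\{0,\ldots,N\}\to\mathbb R$ (bias) solve the Bellman equations $g^*+h(n)=\max_{\lambda\in A_n}\{r_n(\lambda)+\sum_{j=0}^N\mathbf P(j|n,\lambda)h(j)\}$ for $n=0,\ldots,N$. The optimal arrival rate policy is $$\lambda_n^*=\inf\Big(\arg\max_{\lambda\in A_n}\Big\{r_n(\lambda)+\sum_{j=0}^N\mathbf P(j|n,\lambda)h(j)\Big\}\Big),\quad n=0,\ldots,N$$ (so $\lambda_N^*=0$). *)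

theory Defs
  imports "HOL-Probability.Probability"
begin

record queue =
  servers :: nat             (* m *)
  capacity :: nat            (* N *)
  max_rate :: real           (* Lambda *)
  service_rate :: real       (* mu *)
  aband_rate_s :: real       (* theta_s *)
  aband_rate_q :: real       (* theta_q *)
  hold_cost :: real          (* c_h *)
  aband_cost_s :: real       (* c_s *)
  aband_cost_q :: real       (* c_q *)
  val_lo :: real             (* a *)
  val_hi :: real             (* b *)
  val_cdf :: "real \<Rightarrow> real"  (* F *)

text \<open>
  \<open>F\<close> is a continuous distribution function with \<open>F(a) = 0\<close>, \<open>F(b) = 1\<close>. The density is taken
  with respect to Lebesgue measure and is positive at every point of \<open>[a, b]\<close>; it need not be
  continuous.
\<close>

definition valuation_cdf :: "(real \<Rightarrow> real) \<Rightarrow> real \<Rightarrow> real \<Rightarrow> bool" where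
  "valuation_cdf F a b \<longleftrightarrow>
     continuous_on UNIV F \<and> F a = 0 \<and> F b = 1 \<and>
     (\<exists>M f. real_distribution M \<and> F = cdf M \<and>
        f \<in> borel_measurable borel \<and> (\<forall>x. 0 \<le> f x) \<and> (\<forall>x\<in>{a..b}. 0 < f x) \<and>
        M = density lborel (\<lambda>x. ennreal (f x)))"

text \<open>The last equation below is the choice of time unit (uniformization).\<close>

definition valid_queue :: "queue \<Rightarrow> bool" where
  "valid_queue Q \<longleftrightarrow>
     1 \<le> servers Q \<and> servers Q \<le> capacity Q \<and>
     0 < max_rate Q \<and> 0 < service_rate Q \<and> 0 < aband_rate_q Q \<and> 0 \<le> aband_rate_s Q \<and>
     0 \<le> hold_cost Q \<and> 0 \<le> aband_cost_q Q \<and> 0 \<le> aband_cost_s Q \<and>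
     0 \<le> val_lo Q \<and> val_lo Q < val_hi Q \<and>
     valuation_cdf (val_cdf Q) (val_lo Q) (val_hi Q) \<and>
     max_rate Q + real (servers Q) * (service_rate Q + aband_rate_s Q)
       + (real (capacity Q) - real (servers Q)) * aband_rate_q Q = 1"

text \<open>\<open>price Q y\<close> is the generalized inverse of \<open>1 - F\<close> at \<open>y \<in> [0, 1]\<close>.\<close>

definition price :: "queue \<Rightarrow> real \<Rightarrow> real" where
  "price Q y = Inf {x \<in> {val_lo Q..val_hi Q}. 1 - val_cdf Q x \<le> y}"

definition in_service :: "queue \<Rightarrow> nat \<Rightarrow> real" where
  "in_service Q n = min (real n) (real (servers Q))"

definition waiting :: "queue \<Rightarrow> nat \<Rightarrow> real" where
  "waiting Q n = max (real n - real (servers Q)) 0"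

definition death_rate :: "queue \<Rightarrow> nat \<Rightarrow> real" where
  "death_rate Q n =
     in_service Q n * (service_rate Q + aband_rate_s Q) + waiting Q n * aband_rate_q Q"

definition actions :: "queue \<Rightarrow> nat \<Rightarrow> real set" where
  "actions Q n = (if n < capacity Q then {0..max_rate Q} else {0})"

definition reward :: "queue \<Rightarrow> nat \<Rightarrow> real \<Rightarrow> real" where
  "reward Q n l =
     l * price Q (l / max_rate Q) - real n * hold_cost Q
     - in_service Q n * aband_cost_s Q * aband_rate_s Q
     - waiting Q n * aband_cost_q Q * aband_rate_q Q"

text \<open>\<open>trans_prob Q j n l\<close> is the probability of moving to \<open>j\<close> from \<open>n\<close> under action \<open>l\<close>.\<close>

definition trans_prob :: "queue \<Rightarrow> nat \<Rightarrow> nat \<Rightarrow> real \<Rightarrow> real" where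
  "trans_prob Q j n l =
     (if n < capacity Q \<and> j = n + 1 then l
      else if 1 \<le> n \<and> j = n - 1 then death_rate Q n
      else if j = n then 1 - l - death_rate Q n
      else 0)"

definition action_value :: "queue \<Rightarrow> (nat \<Rightarrow> real) \<Rightarrow> nat \<Rightarrow> real \<Rightarrow> real" where
  "action_value Q h n l = reward Q n l + (\<Sum>j=0..capacity Q. trans_prob Q j n l * h j)"

text \<open>
  The maximum in the Bellman equations is attained, i.e. it is not merely a supremum. Only the
  values of \<open>h\<close> on \<open>{0..N}\<close> matter.
\<close>

definition solves_bellman :: "queue \<Rightarrow> real \<Rightarrow> (nat \<Rightarrow> real) \<Rightarrow> bool" where
  "solves_bellman Q g h \<longleftrightarrow>
     (\<forall>n\<le>capacity Q.
        (\<exists>l\<in>actions Q n. g + h n = action_value Q h n l) \<and>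
        (\<forall>l\<in>actions Q n. action_value Q h n l \<le> g + h n))"

definition opt_rate :: "queue \<Rightarrow> (nat \<Rightarrow> real) \<Rightarrow> nat \<Rightarrow> real" where
  "opt_rate Q h n = Inf {l. is_arg_max (action_value Q h n) (\<lambda>x. x \<in> actions Q n) l}"

definition cost_s :: "queue \<Rightarrow> real" where
  "cost_s Q = (hold_cost Q + aband_cost_s Q * aband_rate_s Q) / (service_rate Q + aband_rate_s Q)"

definition cost_q :: "queue \<Rightarrow> real" where
  "cost_q Q = hold_cost Q / aband_rate_q Q + aband_cost_q Q"

end

theory Submission
  imports Defs
begin

text \<open>
  Let \<open>d n = h n - h (n + 1)\<close> be the bias lost when one more customer is admitted in state \<open>n\<close>.
  Up to terms that do not involve the action, the value of an arrival rate \<open>l\<close> is the revenue rate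
  of \<open>l\<close> minus \<open>l * d n\<close>. Hence the maximal rates fall as \<open>d n\<close> rises
  (\<open>maximizers_antimono_in_charge\<close>), and it suffices that \<open>d\<close> is nondecreasing, that is, that \<open>h\<close>
  is concave.

  Let \<open>V n\<close> be the maximum of revenue minus charge in state \<open>n\<close>. It is nonnegative, because the
  rate \<open>0\<close> earns nothing and is not charged; it is \<open>0\<close> in the full state \<open>N\<close>; and a larger \<open>V\<close>
  means a smaller \<open>d\<close>. Subtracting two consecutive Bellman equations gives
    \<open>V n - V (n + 1) = \<gamma> n * (d n - d (n - 1)) + \<alpha> n * (d n - C n)\<close>,
  where \<open>\<alpha> n = \<gamma> (n + 1) - \<gamma> n > 0\<close> and \<open>C n\<close> is \<open>cost_s\<close> while a server is free and \<open>cost_q\<close>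
  otherwise. The condition \<open>cost_s \<le> cost_q\<close> says exactly that \<open>C\<close> is nondecreasing.

  This recursion forces \<open>d\<close> to be monotone. Once \<open>d\<close> has decreased to a value below \<open>C\<close>,
  the right-hand side is negative, so \<open>V\<close> rises, so \<open>d\<close> decreases again and is still below
  \<open>C\<close>; this goes on up to the full state, where \<open>V\<close> would have to rise to \<open>0\<close> from a
  nonnegative value (\<open>no_drop_below_threshold\<close>). A first decrease of \<open>d\<close> that does not end below \<open>C\<close>
  starts above \<open>C\<close>; but then the right-hand side is positive where it starts, so \<open>V\<close> falls and
  \<open>d\<close> rises (\<open>charge_nondecreasing\<close>).
\<close>

section \<open>A monotonicity principle for second-order recursions\<close>

text \<open>
  The recursion is read at \<open>n = 0\<close> as well, where \<open>d (n - 1)\<close> is \<open>d 0\<close> and the first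
  term on the right vanishes.
\<close>

locale threshold_recursion =
  fixes N :: nat and V d \<gamma> \<alpha> C :: "nat \<Rightarrow> real"
  assumes V_nonneg: "\<And>n. n < N \<Longrightarrow> 0 \<le> V n"
    and V_full: "V N = 0"
    and V_antimono: "\<And>i j. i < N \<Longrightarrow> j < N \<Longrightarrow> V i < V j \<Longrightarrow> d j < d i"
    and recursion: "\<And>n. n < N \<Longrightarrow>
      V n - V (Suc n) = \<gamma> n * (d n - d (n - 1)) + \<alpha> n * (d n - C n)"
    and \<gamma>_nonneg: "\<And>n. 0 \<le> \<gamma> n"
    and \<alpha>_pos: "\<And>n. 0 < \<alpha> n"
    and C_mono: "\<And>n. C n \<le> C (Suc n)"
begin

text \<open>
  A drop that ends below the threshold would propagate to the full state, hence the induction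
  from \<open>N\<close> downwards.
\<close>

lemma no_drop_below_threshold:
  assumes "n < N" "d n < C n"
  shows "d (n - 1) \<le> d n"
  using assms
proof (induction "N - n" arbitrary: n rule: less_induct)
  case less
  show ?case
  proof (rule ccontr)
    assume "\<not> ?thesis"
    then have "\<gamma> n * (d n - d (n - 1)) \<le> 0"
      using \<gamma>_nonneg by (intro mult_nonneg_nonpos) auto
    moreover have "\<alpha> n * (d n - C n) < 0"
      using \<alpha>_pos less.prems(2) by (intro mult_pos_neg) auto
    ultimately have rise: "V n < V (Suc n)"
      using recursion[OF less.prems(1)] by linarith
    show False
    proof (cases "Suc n < N")
      case True
      then have drop: "d (Suc n) < d n"
        using V_antimono rise less.prems(1) by blast
      then have "d (Suc n) < C (Suc n)"
        using less.prems(2) C_mono[of n] by linarith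
      then show False
        using less.hyps[of "Suc n"] True drop by (simp add: diff_less_mono2)
    next
      case False
      then have "Suc n = N"
        using less.prems(1) by simp
      then show False
        using rise V_full V_nonneg[OF less.prems(1)] by simp
    qed
  qed
qed

lemma charge_nondecreasing:
  assumes "Suc n < N"
  shows "d n \<le> d (Suc n)"
  using assms
proof (induction n rule: less_induct)
  case (less n)
  have before: "d (n - 1) \<le> d n"
    using less by (cases n) auto
  show ?case
  proof (rule ccontr)
    assume drop: "\<not> ?thesis"
    then have "C (Suc n) \<le> d (Suc n)"
      using no_drop_below_threshold[of "Suc n"] less.prems by force
    then have "C n < d n"
      using drop C_mono[of n] by linarith
    then have "0 < \<alpha> n * (d n - C n)"
      using \<alpha>_pos by simp
    moreover have "0 \<le> \<gamma> n * (d n - d (n - 1))"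
      using before \<gamma>_nonneg by simp
    ultimately have "V (Suc n) < V n"
      using recursion[of n] less.prems by simp
    then show False
      using V_antimono[of "Suc n" n] less.prems drop by simp
  qed
qed

end

section \<open>Maximizers under a linear charge\<close>

text \<open>
  Two rates that are optimal for different charges can be exchanged; adding the two optimality
  inequalities leaves \<open>(d' - d) * (y - x) \<le> 0\<close>.
\<close>

lemma maximizers_antimono_in_charge:
  fixes R :: "real \<Rightarrow> real"
  assumes "d < d'" "x \<in> A" "y \<in> A"
    and "\<And>l. l \<in> A \<Longrightarrow> R l - l * d \<le> R x - x * d"
    and "\<And>l. l \<in> A \<Longrightarrow> R l - l * d' \<le> R y - y * d'"
  shows "y \<le> x"
proof -
  have "R y - y * d \<le> R x - x * d" "R x - x * d' \<le> R y - y * d'"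
    using assms by auto
  then have "(d' - d) * (y - x) \<le> 0"
    by (simp add: algebra_simps)
  then show ?thesis
    using assms(1) by (simp add: mult_le_0_iff)
qed

section \<open>The Bellman equations in terms of bias differences\<close>

definition revenue :: "queue \<Rightarrow> real \<Rightarrow> real" where
  "revenue Q l = l * price Q (l / max_rate Q)"

definition running_cost :: "queue \<Rightarrow> nat \<Rightarrow> real" where
  "running_cost Q n = real n * hold_cost Q + in_service Q n * aband_cost_s Q * aband_rate_s Q
     + waiting Q n * aband_cost_q Q * aband_rate_q Q"

definition bias_loss :: "(nat \<Rightarrow> real) \<Rightarrow> nat \<Rightarrow> real" where
  "bias_loss h n = h n - h (Suc n)"

text \<open>
  For a solution of the Bellman equations this is the maximum of
  \<open>revenue Q l - l * bias_loss h n\<close> over the actions \<open>l\<close>, and \<open>0\<close> in the full state.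
\<close>

definition net_revenue :: "queue \<Rightarrow> real \<Rightarrow> (nat \<Rightarrow> real) \<Rightarrow> nat \<Rightarrow> real" where
  "net_revenue Q g h n = g + running_cost Q n - death_rate Q n * bias_loss h (n - 1)"

definition rate_step :: "queue \<Rightarrow> nat \<Rightarrow> real" where
  "rate_step Q n = (if n < servers Q then service_rate Q + aband_rate_s Q else aband_rate_q Q)"

definition cost_threshold :: "queue \<Rightarrow> nat \<Rightarrow> real" where
  "cost_threshold Q n = (if n < servers Q then cost_s Q else cost_q Q)"

lemma death_rate_Suc: "death_rate Q (Suc n) = death_rate Q n + rate_step Q n"
  by (auto simp: death_rate_def in_service_def waiting_def rate_step_def min_def max_def
      algebra_simps)

lemma running_cost_Suc:
  assumes "valid_queue Q"
  shows "running_cost Q (Suc n) = running_cost Q n + rate_step Q n * cost_threshold Q n"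
proof -
  have s: "(service_rate Q + aband_rate_s Q) * cost_s Q
      = hold_cost Q + aband_cost_s Q * aband_rate_s Q"
    using assms by (simp add: valid_queue_def cost_s_def)
  have q: "aband_rate_q Q * cost_q Q = hold_cost Q + aband_cost_q Q * aband_rate_q Q"
    using assms by (simp add: valid_queue_def cost_q_def field_simps)
  have "running_cost Q (Suc n) = running_cost Q n +
      (if n < servers Q then hold_cost Q + aband_cost_s Q * aband_rate_s Q
       else hold_cost Q + aband_cost_q Q * aband_rate_q Q)"
    by (auto simp: running_cost_def in_service_def waiting_def algebra_simps)
  then show ?thesis
    unfolding s[symmetric] q[symmetric] by (simp add: rate_step_def cost_threshold_def)
qed

lemma action_value_eq:
  assumes "n \<le> capacity Q" "l \<in> actions Q n"
  shows "action_value Q h n l = revenue Q l - l * bias_loss h n + h n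
           - running_cost Q n + death_rate Q n * bias_loss h (n - 1)"
proof -
  let ?N = "capacity Q" and ?\<gamma> = "death_rate Q n"
  have "trans_prob Q j n l * h j =
      (if j = Suc n then (if n < ?N then l * h (Suc n) else 0) else 0)
      + (if j = n - 1 then (if 1 \<le> n then ?\<gamma> * h (n - 1) else 0) else 0)
      + (if j = n then (1 - l - ?\<gamma>) * h n else 0)" if "j \<le> ?N" for j
    using that assms(1) by (cases n) (auto simp: trans_prob_def)
  then have "(\<Sum>j=0..?N. trans_prob Q j n l * h j) =
      (\<Sum>j=0..?N. (if j = Suc n then (if n < ?N then l * h (Suc n) else 0) else 0)
      + (if j = n - 1 then (if 1 \<le> n then ?\<gamma> * h (n - 1) else 0) else 0)
      + (if j = n then (1 - l - ?\<gamma>) * h n else 0))"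
    by (intro sum.cong) auto
  also have "\<dots> = (if n < ?N then l * h (Suc n) else 0)
      + (if 1 \<le> n then ?\<gamma> * h (n - 1) else 0) + (1 - l - ?\<gamma>) * h n"
    using assms(1) by (auto simp: sum.distrib sum.delta)
  \<comment> \<open>The terms missing at the two ends are multiples of \<open>l = 0\<close> and of \<open>death_rate Q 0 = 0\<close>.\<close>
  also have "\<dots> = l * h (Suc n) + ?\<gamma> * h (n - 1) + (1 - l - ?\<gamma>) * h n"
    using assms by (auto simp: actions_def death_rate_def in_service_def waiting_def
        split: if_splits)
  also have "\<dots> = h n - l * bias_loss h n + ?\<gamma> * bias_loss h (n - 1)"
    by (cases n) (auto simp: bias_loss_def death_rate_def in_service_def waiting_def algebra_simps)
  finally show ?thesis
    by (simp add: action_value_def reward_def revenue_def running_cost_def)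
qed

lemma revenue_minus_charge_le:
  assumes "solves_bellman Q g h" "n \<le> capacity Q" "l \<in> actions Q n"
  shows "revenue Q l - l * bias_loss h n \<le> net_revenue Q g h n"
  using assms action_value_eq[of n Q l h] by (force simp: solves_bellman_def net_revenue_def)

lemma revenue_minus_charge_attained:
  assumes "solves_bellman Q g h" "n \<le> capacity Q"
  obtains l where "l \<in> actions Q n" "net_revenue Q g h n = revenue Q l - l * bias_loss h n"
proof -
  obtain l where l: "l \<in> actions Q n" "g + h n = action_value Q h n l"
    using assms unfolding solves_bellman_def by blast
  then have "net_revenue Q g h n = revenue Q l - l * bias_loss h n"
    using action_value_eq[OF assms(2) l(1), of h] by (simp add: net_revenue_def)
  with l(1) show thesis
    by (rule that)
qed

lemma actions_nonneg: "l \<in> actions Q n \<Longrightarrow> 0 \<le> l"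
  by (auto simp: actions_def split: if_splits)

lemma net_revenue_recursion:
  assumes "valid_queue Q"
  shows "net_revenue Q g h n - net_revenue Q g h (Suc n) =
    death_rate Q n * (bias_loss h n - bias_loss h (n - 1))
    + rate_step Q n * (bias_loss h n - cost_threshold Q n)"
  by (simp add: net_revenue_def running_cost_Suc[OF assms] death_rate_Suc algebra_simps)

text \<open>A smaller charge leaves at least as much of the revenue of each rate.\<close>

lemma net_revenue_antimono:
  assumes "solves_bellman Q g h" "i < capacity Q" "j < capacity Q"
    and "net_revenue Q g h i < net_revenue Q g h j"
  shows "bias_loss h j < bias_loss h i"
proof (rule ccontr)
  assume "\<not> ?thesis"
  then have charge: "bias_loss h i \<le> bias_loss h j"
    by simp
  obtain l where l: "l \<in> actions Q j" "net_revenue Q g h j = revenue Q l - l * bias_loss h j"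
    using revenue_minus_charge_attained[OF assms(1)] assms(3) by (metis less_imp_le)
  then have "l * bias_loss h i \<le> l * bias_loss h j"
    using charge by (intro mult_left_mono actions_nonneg)
  moreover have "l \<in> actions Q i"
    using l(1) assms(2,3) by (simp add: actions_def)
  then have "revenue Q l - l * bias_loss h i \<le> net_revenue Q g h i"
    using revenue_minus_charge_le[OF assms(1)] assms(2) by simp
  ultimately show False
    using l(2) assms(4) by linarith
qed

section \<open>Concavity of the bias and monotonicity of the policy\<close>

lemma bias_loss_nondecreasing:
  assumes valid: "valid_queue Q" and bellman: "solves_bellman Q g h"
    and costs: "cost_s Q \<le> cost_q Q" and n: "Suc n < capacity Q"
  shows "bias_loss h n \<le> bias_loss h (Suc n)"
proof -
  interpret threshold_recursion "capacity Q" "net_revenue Q g h" "bias_loss h" "death_rate Q"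
    "rate_step Q" "cost_threshold Q"
  proof
    fix k
    show "0 \<le> net_revenue Q g h k" if "k < capacity Q"
      using revenue_minus_charge_le[OF bellman, of k 0] that valid
      by (simp add: actions_def revenue_def valid_queue_def)
    show "net_revenue Q g h (capacity Q) = 0"
      by (rule revenue_minus_charge_attained[OF bellman order_refl])
        (simp add: actions_def revenue_def)
    show "0 \<le> death_rate Q k"
      using valid by (simp add: death_rate_def in_service_def waiting_def valid_queue_def)
    show "0 < rate_step Q k"
      using valid by (simp add: rate_step_def valid_queue_def)
    show "cost_threshold Q k \<le> cost_threshold Q (Suc k)"
      using costs by (simp add: cost_threshold_def)
  qed (use net_revenue_antimono[OF bellman] net_revenue_recursion[OF valid] in auto)
  show ?thesis
    using n by (rule charge_nondecreasing)
qed

lemma is_arg_max_action_value_iff: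
  assumes "solves_bellman Q g h" "n \<le> capacity Q"
  shows "is_arg_max (action_value Q h n) (\<lambda>x. x \<in> actions Q n) l \<longleftrightarrow>
    l \<in> actions Q n \<and> revenue Q l - l * bias_loss h n = net_revenue Q g h n"
proof -
  have "is_arg_max (action_value Q h n) (\<lambda>x. x \<in> actions Q n) l \<longleftrightarrow>
      l \<in> actions Q n \<and> action_value Q h n l = g + h n"
    using assms unfolding solves_bellman_def is_arg_max_def
    by (metis linorder_not_le order_antisym_conv)
  also have "\<dots> \<longleftrightarrow> l \<in> actions Q n \<and> revenue Q l - l * bias_loss h n = net_revenue Q g h n"
    using action_value_eq[OF assms(2)] by (auto simp: net_revenue_def)
  finally show ?thesis .
qed

theorem theorem4p2:
  fixes Q :: queue and g :: real and h :: "nat \<Rightarrow> real"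
  assumes "valid_queue Q"
    and "solves_bellman Q g h"
    and "cost_s Q \<le> cost_q Q"
  shows "\<forall>n<capacity Q. opt_rate Q h n \<ge> opt_rate Q h (n + 1)"
proof (intro allI impI)
  fix n assume n: "n < capacity Q"
  let ?O = "\<lambda>k. {l \<in> actions Q k. revenue Q l - l * bias_loss h k = net_revenue Q g h k}"
  have opt_rate: "opt_rate Q h k = Inf (?O k)" if "k \<le> capacity Q" for k
    using is_arg_max_action_value_iff[OF assms(2) that] by (simp add: opt_rate_def)
  have nonempty: "?O k \<noteq> {}" if "k \<le> capacity Q" for k
    using revenue_minus_charge_attained[OF assms(2) that] by (metis (mono_tags, lifting)
        empty_iff mem_Collect_eq)
  have bdd: "bdd_below (?O k)" for k
    using actions_nonneg by (intro bdd_belowI[of _ 0]) auto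
  \<comment> \<open>Maximizers need not be unique, so equal charges are a case of their own: the sets of
     maximizers then coincide, but their elements are not ordered.\<close>
  consider "Suc n = capacity Q" | "Suc n < capacity Q" "bias_loss h n = bias_loss h (Suc n)"
    | "Suc n < capacity Q" "bias_loss h n < bias_loss h (Suc n)"
    using n bias_loss_nondecreasing[OF assms, of n] by linarith
  then have "Inf (?O (Suc n)) \<le> Inf (?O n)"
  proof cases
    case 1
    then have "?O (Suc n) = {0}"
      using nonempty[of "Suc n"] by (auto simp: actions_def)
    moreover have "0 \<le> Inf (?O n)"
      using nonempty[of n] n by (intro cInf_greatest) (auto intro: actions_nonneg)
    ultimately show ?thesis
      by simp
  next
    case 2
    then have actions: "actions Q (Suc n) = actions Q n"
      by (simp add: actions_def)
    have "net_revenue Q g h n = net_revenue Q g h (Suc n)"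
      using net_revenue_antimono[OF assms(2), of n "Suc n"]
        net_revenue_antimono[OF assms(2), of "Suc n" n] 2 by fastforce
    then show ?thesis
      using 2 actions by simp
  next
    case 3
    then have actions: "actions Q (Suc n) = actions Q n"
      by (simp add: actions_def)
    have below: "y \<le> x" if "x \<in> ?O n" "y \<in> ?O (Suc n)" for x y
    proof (rule maximizers_antimono_in_charge[OF 3(2)])
      show "x \<in> actions Q n" "y \<in> actions Q n"
        using that actions by auto
      fix l assume l: "l \<in> actions Q n"
      show "revenue Q l - l * bias_loss h n \<le> revenue Q x - x * bias_loss h n"
        using revenue_minus_charge_le[OF assms(2) _ l] n that by simp
      show "revenue Q l - l * bias_loss h (Suc n) \<le> revenue Q y - y * bias_loss h (Suc n)"
        using revenue_minus_charge_le[OF assms(2), of "Suc n" l] l 3(1) that actions by simp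
    qed
    show ?thesis
    proof (rule cInf_greatest[OF nonempty])
      fix x assume x: "x \<in> ?O n"
      obtain y where y: "y \<in> ?O (Suc n)"
        using nonempty[of "Suc n"] n by fastforce
      show "Inf (?O (Suc n)) \<le> x"
        using cInf_lower[OF y bdd] below[OF x y] by linarith
    qed (use n in simp)
  qed
  then show "opt_rate Q h n \<ge> opt_rate Q h (n + 1)"
    using opt_rate n by simp
qed

end
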